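(* Let $\epsilon\in\{1,-1\}$ and let $Q,V,H,J$ be real constants with $Q\neq 0$ and $V-\epsilon H\neq 0$. On $\mathbb{R}^3$ with coordinates $u=(u_1,u_2,u_3)$ let $\widetilde G$ be the symmetric tensor with components $$\widetilde G_{11}=\widetilde G_{22}=Q e^{-2\epsilon u_3},\qquad \widetilde G_{12}=\widetilde G_{21}=\epsilon Q e^{-2\epsilon u_3},$$ $$\widetilde G_{13}=\widetilde G_{31}=V\cosh u_3-H\sinh u_3,\qquad \widetilde G_{23}=\widetilde G_{32}=H\cosh u_3-V\sinh u_3,\qquad \widetilde G_{33}=J .$$ Then the pseudo-Riemannian metric $\widetilde G$ has nonvanishing Ricci tensor and zero scalar curvature. Moreover, let $c_0,c_1,c_2,c_3$ be real constants with $v c_2^2+2q c_1c_3=0$, where $q=Q^{-1}$, $v=V-\epsilon H$, and consider the Poisson--Lie transformed dilaton $$\Phi_U(y)=-2y_1+c_1e^{-y_1}+c_2e^{-y_1}y_2+c_3\Big(\frac{q}{2v}e^{-y_1}y_2^2+y_3\Big)+c_0$$ with $y=(y_1,y_2,y_3)$ expressed through $u$ and the auxiliary variables $\tilde u=(\tilde u_1,\tilde u_2,\tilde u_3)\in\mathbb{R}^3$ by $$y_1=-\epsilon u_3,\qquad y_2=\frac{\epsilon\tilde u_1+\tilde u_2}{2},\qquad y_3=\frac{-\epsilon u_1+u_2}{2}+\beta u_3,$$ where $\alpha=\frac{\epsilon V+H}{2Q}$ and $\beta=\epsilon\frac{\alpha^2Q-J}{2v}$. Then $\Phi_U(y(u,\tilde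 u))$ is independent of $\tilde u$ if and only if $c_2=c_3=0$; in that case it equals $$\widetilde\Phi(u)=2\epsilon u_3+c_1e^{\epsilon u_3}+c_0,$$ and, for all real $c_0,c_1$, the pair $(\widetilde G,\widetilde\Phi)$ (with vanishing torsion) satisfies the vanishing $\beta$ equations.
   Context: The vanishing $\beta$ equations for a metric $G_{ij}$, a dilaton (smooth function) $\Phi$ and a torsion 3-form $H_{ijk}$ (not to be confused with the real constant $H$) are $$0=R_{ij}-\nabla_i\nabla_j\Phi-\tfrac14 H_{imn}H_j{}^{mn},$$ $$0=H_{kij}\nabla^k\Phi+\nabla^kH_{kij},$$ $$0=R-2\nabla_k\nabla^k\Phi-\nabla_k\Phi\nabla^k\Phi-\tfrac1{12}H_{kmn}H^{kmn}.$$ Here $\nabla$ is the Levi-Civita connection of $G$, $R_{ij}$ its Ricci tensor (usual sign convention, in which round spheres have positive Ricci curvature), $R$ its scalar curvature (called Gauss curvature in the paper), and indices are raised and lowered with $G$. With vanishing torsion, $H_{ijk}=0$, they reduce to $R_{ij}=\nabla_i\nabla_j\Phi$ and $R-2\nabla_k\nabla^k\Phi-\nabla_k\Phi\nabla^k\Phi=0$. The coordinates $y$ are coordinates on the group of a flat sigma model (Manin triple $(5|1)$), $u$ are coordinates on the group of the transformed model (Manin triple $(6_0|1)$ of the same Drinfel'd double), and $\tilde u$ are coordinates on the dual (auxiliary) group of the transformed model. A transformed dilaton is admissible only if it does not depend on $\tilde u$. *)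

theory Defs
  imports "HOL-Analysis.Analysis"
begin

definition partial :: "'n::finite \<Rightarrow> (real^'n \<Rightarrow> real) \<Rightarrow> real^'n \<Rightarrow> real" where
  "partial i f x = deriv (\<lambda>t. f (x + t *\<^sub>R axis i 1)) 0"

fun continuously_diff :: "nat \<Rightarrow> (real^'n::finite \<Rightarrow> real) \<Rightarrow> bool" where
  "continuously_diff 0 f \<longleftrightarrow> continuous_on UNIV f"
| "continuously_diff (Suc k) f \<longleftrightarrow>
     (\<forall>x. f differentiable (at x)) \<and> (\<forall>i. continuously_diff k (partial i f))"

definition smooth_function :: "(real^'n::finite \<Rightarrow> real) \<Rightarrow> bool" where
  "smooth_function f \<longleftrightarrow> (\<forall>k. continuously_diff k f)"

definition pseudo_riemannian_metric :: "(real^'n::finite \<Rightarrow> real^'n^'n) \<Rightarrow> bool" where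
  "pseudo_riemannian_metric G \<longleftrightarrow>
     (\<forall>i j. smooth_function (\<lambda>x. G x $ i $ j)) \<and>
     (\<forall>x. transpose (G x) = G x \<and> invertible (G x))"

text \<open>In the following, tensor components are functions of the indices and then of the point.
  \<open>inv_metric G i j\<close> is \<open>G\<^sup>i\<^sup>j\<close>.\<close>

definition inv_metric ::
    "(real^'n::finite \<Rightarrow> real^'n^'n) \<Rightarrow> 'n \<Rightarrow> 'n \<Rightarrow> real^'n \<Rightarrow> real" where
  "inv_metric G i j x = matrix_inv (G x) $ i $ j"

text \<open>\<open>christoffel G k i j\<close> has upper index \<open>k\<close> and lower indices \<open>i\<close>, \<open>j\<close>.\<close>

definition christoffel ::
    "(real^'n::finite \<Rightarrow> real^'n^'n) \<Rightarrow> 'n \<Rightarrow> 'n \<Rightarrow> 'n \<Rightarrow> real^'n \<Rightarrow> real" where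
  "christoffel G k i j x =
     (1/2) * (\<Sum>l\<in>UNIV. inv_metric G k l x *
        (partial i (\<lambda>z. G z $ j $ l) x + partial j (\<lambda>z. G z $ i $ l) x
         - partial l (\<lambda>z. G z $ i $ j) x))"

text \<open>\<open>riemann G k l i j\<close> is the component along \<open>\<partial>\<^sub>k\<close> of
  \<open>(\<nabla>\<^sub>i \<nabla>\<^sub>j - \<nabla>\<^sub>j \<nabla>\<^sub>i) \<partial>\<^sub>l\<close>; contracting \<open>k\<close> with \<open>i\<close> makes the Ricci tensor of round
  spheres positive.\<close>

definition riemann ::
    "(real^'n::finite \<Rightarrow> real^'n^'n) \<Rightarrow> 'n \<Rightarrow> 'n \<Rightarrow> 'n \<Rightarrow> 'n \<Rightarrow> real^'n \<Rightarrow> real" where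
  "riemann G k l i j x =
     partial i (christoffel G k j l) x - partial j (christoffel G k i l) x
     + (\<Sum>m\<in>UNIV. christoffel G k i m x * christoffel G m j l x
                   - christoffel G k j m x * christoffel G m i l x)"

definition ricci ::
    "(real^'n::finite \<Rightarrow> real^'n^'n) \<Rightarrow> 'n \<Rightarrow> 'n \<Rightarrow> real^'n \<Rightarrow> real" where
  "ricci G i j x = (\<Sum>k\<in>UNIV. riemann G k i k j x)"

definition scalar_curvature :: "(real^'n::finite \<Rightarrow> real^'n^'n) \<Rightarrow> real^'n \<Rightarrow> real" where
  "scalar_curvature G x = (\<Sum>i\<in>UNIV. \<Sum>j\<in>UNIV. inv_metric G i j x * ricci G i j x)"

text \<open>Covariant derivatives of covector fields and of covariant 3-tensors; the first index
  is that of the derivative.\<close>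

definition nabla_covector ::
    "(real^'n::finite \<Rightarrow> real^'n^'n) \<Rightarrow> ('n \<Rightarrow> real^'n \<Rightarrow> real) \<Rightarrow> 'n \<Rightarrow> 'n \<Rightarrow> real^'n \<Rightarrow> real" where
  "nabla_covector G w i j x =
     partial i (w j) x - (\<Sum>k\<in>UNIV. christoffel G k i j x * w k x)"

definition nabla_3tensor ::
    "(real^'n::finite \<Rightarrow> real^'n^'n) \<Rightarrow> ('n \<Rightarrow> 'n \<Rightarrow> 'n \<Rightarrow> real^'n \<Rightarrow> real)
      \<Rightarrow> 'n \<Rightarrow> 'n \<Rightarrow> 'n \<Rightarrow> 'n \<Rightarrow> real^'n \<Rightarrow> real" where
  "nabla_3tensor G T l k i j x =
     partial l (T k i j) x
     - (\<Sum>m\<in>UNIV. christoffel G m l k x * T m i j x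
                   + christoffel G m l i x * T k m j x
                   + christoffel G m l j x * T k i m x)"

definition nabla_nabla ::
    "(real^'n::finite \<Rightarrow> real^'n^'n) \<Rightarrow> (real^'n \<Rightarrow> real) \<Rightarrow> 'n \<Rightarrow> 'n \<Rightarrow> real^'n \<Rightarrow> real" where
  "nabla_nabla G \<Phi> i j x = nabla_covector G (\<lambda>k. partial k \<Phi>) i j x"

text \<open>\<open>T\<close> is the torsion 3-form \<open>H\<^sub>i\<^sub>j\<^sub>k\<close>; the equations make sense without its antisymmetry,
  which is therefore not built in.\<close>

definition vanishing_beta_equations ::
    "(real^'n::finite \<Rightarrow> real^'n^'n) \<Rightarrow> (real^'n \<Rightarrow> real)
      \<Rightarrow> ('n \<Rightarrow> 'n \<Rightarrow> 'n \<Rightarrow> real^'n \<Rightarrow> real) \<Rightarrow> bool" where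
  "vanishing_beta_equations G \<Phi> T \<longleftrightarrow>
     (\<forall>x i j. 0 = ricci G i j x - nabla_nabla G \<Phi> i j x
        - (1/4) * (\<Sum>m\<in>UNIV. \<Sum>n\<in>UNIV. \<Sum>p\<in>UNIV. \<Sum>q\<in>UNIV.
             inv_metric G m p x * inv_metric G n q x * T i m n x * T j p q x)) \<and>
     (\<forall>x i j. 0 =
        (\<Sum>k\<in>UNIV. \<Sum>l\<in>UNIV. inv_metric G k l x * T k i j x * partial l \<Phi> x)
        + (\<Sum>k\<in>UNIV. \<Sum>l\<in>UNIV. inv_metric G k l x * nabla_3tensor G T l k i j x)) \<and>
     (\<forall>x. 0 = scalar_curvature G x
        - 2 * (\<Sum>k\<in>UNIV. \<Sum>l\<in>UNIV. inv_metric G k l x * nabla_nabla G \<Phi> k l x)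
        - (\<Sum>k\<in>UNIV. \<Sum>l\<in>UNIV. inv_metric G k l x * partial k \<Phi> x * partial l \<Phi> x)
        - (1/12) * (\<Sum>k\<in>UNIV. \<Sum>m\<in>UNIV. \<Sum>n\<in>UNIV. \<Sum>l\<in>UNIV. \<Sum>p\<in>UNIV. \<Sum>q\<in>UNIV.
             inv_metric G k l x * inv_metric G m p x * inv_metric G n q x
             * T k m n x * T l p q x))"

definition G_transf :: "real \<Rightarrow> real \<Rightarrow> real \<Rightarrow> real \<Rightarrow> real \<Rightarrow> real^3 \<Rightarrow> real^3^3" where
  "G_transf \<epsilon> Q V H J u = vector [
     vector [Q * exp (- 2 * \<epsilon> * u$3), \<epsilon> * Q * exp (- 2 * \<epsilon> * u$3), V * cosh (u$3) - H * sinh (u$3)],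
     vector [\<epsilon> * Q * exp (- 2 * \<epsilon> * u$3), Q * exp (- 2 * \<epsilon> * u$3), H * cosh (u$3) - V * sinh (u$3)],
     vector [V * cosh (u$3) - H * sinh (u$3), H * cosh (u$3) - V * sinh (u$3), J]]"

text \<open>\<open>u\<close> are the coordinates of the transformed model, \<open>ut\<close> those of its dual group.\<close>

definition y_coords :: "real \<Rightarrow> real \<Rightarrow> real^3 \<Rightarrow> real^3 \<Rightarrow> real^3" where
  "y_coords \<epsilon> \<beta> u ut = vector [
     - \<epsilon> * u$3,
     (\<epsilon> * ut$1 + ut$2) / 2,
     (- \<epsilon> * u$1 + u$2) / 2 + \<beta> * u$3]"

definition Phi_U ::
    "real \<Rightarrow> real \<Rightarrow> real \<Rightarrow> real \<Rightarrow> real \<Rightarrow> real \<Rightarrow> real^3 \<Rightarrow> real" where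
  "Phi_U q v c0 c1 c2 c3 y =
     - 2 * y$1 + c1 * exp (- (y$1)) + c2 * exp (- (y$1)) * y$2
     + c3 * (q / (2 * v) * exp (- (y$1)) * (y$2)^2 + y$3) + c0"

definition Phi_transf :: "real \<Rightarrow> real \<Rightarrow> real \<Rightarrow> real^3 \<Rightarrow> real" where
  "Phi_transf \<epsilon> c0 c1 u = 2 * \<epsilon> * u$3 + c1 * exp (\<epsilon> * u$3) + c0"

definition independent_of_dual :: "(real^3 \<Rightarrow> real^3 \<Rightarrow> real) \<Rightarrow> bool" where
  "independent_of_dual F \<longleftrightarrow> (\<forall>u ut ut'. F u ut = F u ut')"

end

theory Submission
  imports Defs
begin

text \<open>The metric is a plane wave: in terms of \<open>X = u\<^sub>1 + \<epsilon> u\<^sub>2\<close>, \<open>Y = u\<^sub>1 - \<epsilon> u\<^sub>2\<close>, \<open>s = u\<^sub>3\<close> and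
  \<open>v = V - \<epsilon> H\<close> it is
  \<open>Q e\<^bsup>-2\<epsilon>s\<^esup> dX\<^sup>2 + (V + \<epsilon> H) e\<^bsup>-\<epsilon>s\<^esup> dX ds + v e\<^bsup>\<epsilon>s\<^esup> dY ds + J ds\<^sup>2\<close>, so its determinant is the
  constant \<open>- Q v\<^sup>2\<close> and \<open>s\<close> is a null coordinate, \<open>G\<^sup>3\<^sup>3 = 0\<close>. The only nonzero Christoffel symbol
  with upper index 3 is \<open>\<Gamma>\<^sup>3\<^sub>3\<^sub>3 = \<epsilon>\<close>, and the only nonzero Ricci component is \<open>R\<^sub>3\<^sub>3 = -2\<close>.
  For a dilaton \<open>f(s)\<close> the beta equations therefore reduce to \<open>f'' - \<epsilon> f' = -2\<close>, all scalar
  contractions being multiples of \<open>G\<^sup>3\<^sup>3\<close>.\<close>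

section \<open>Functions of a single coordinate, and matrix inverses\<close>

text \<open>No differentiability is assumed: where \<open>g\<close> is not differentiable, both sides are the same
  arbitrary value.\<close>

lemma partial_comp_coord:
  fixes g :: "real \<Rightarrow> real" and x :: "real^'n::finite"
  shows "partial i (\<lambda>x. g (x $ m)) x = (if i = m then deriv g (x $ m) else 0)"
proof (cases "i = m")
  case True
  have "((\<lambda>t. g (x $ m + t)) has_real_derivative D) (at 0) \<longleftrightarrow>
      (g has_real_derivative D) (at (x $ m))" for D
    using DERIV_shift[of g D 0 "x $ m"] by (simp add: add.commute)
  then show ?thesis
    using True by (simp add: partial_def deriv_def)
next
  case False
  then show ?thesis by (simp add: partial_def axis_def)
qed

text \<open>\<open>F n\<close> stands for the \<open>n\<close>-th derivative. A partial derivative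
  of \<open>F n\<close> composed with a coordinate is \<open>F (Suc n)\<close> composed with it, or
  zero, so this family together with 0 is closed under \<open>partial\<close>.\<close>

lemma smooth_function_comp_coord:
  fixes F :: "nat \<Rightarrow> real \<Rightarrow> real"
  assumes F: "\<And>n s. (F n has_real_derivative F (Suc n) s) (at s)"
  shows "smooth_function (\<lambda>x::real^'n::finite. F 0 (x $ m))"
proof -
  have cont: "continuous_on UNIV (\<lambda>x::real^'n. F n (x $ m))" for n
    by (rule continuous_on_compose2[of UNIV "F n"])
       (auto intro!: continuous_intros DERIV_continuous_on F)
  have diff: "(\<lambda>x::real^'n. F n (x $ m)) differentiable (at x)" for n x
  proof -
    have "F n differentiable (at (x $ m))"
      using F real_differentiable_def by blast
    moreover have "(\<lambda>x::real^'n. x $ m) differentiable (at x)"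
      by (simp add: bounded_linear_imp_differentiable bounded_linear_vec_nth)
    ultimately show ?thesis
      using differentiable_chain_at[of "\<lambda>x. x $ m" x "F n"] by (simp add: o_def)
  qed
  have zero: "continuously_diff k (\<lambda>x::real^'n. 0)" for k
  proof (induction k)
    case (Suc k)
    have "partial i (\<lambda>x::real^'n. 0) = (\<lambda>x. 0)" for i
      by (simp add: partial_def fun_eq_iff)
    with Suc show ?case by simp
  qed auto
  have "continuously_diff k (\<lambda>x::real^'n. F n (x $ m))" for k n
  proof (induction k arbitrary: n)
    case 0
    then show ?case by (simp add: cont)
  next
    case (Suc k)
    have "partial i (\<lambda>x::real^'n. F n (x $ m)) =
        (if i = m then \<lambda>x. F (Suc n) (x $ m) else (\<lambda>x. 0))" for i
      by (auto simp: fun_eq_iff partial_comp_coord DERIV_imp_deriv[OF F])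
    with Suc diff zero show ?case by simp
  qed
  then show ?thesis by (simp add: smooth_function_def)
qed

text \<open>For square matrices a right inverse is two-sided and hence unique, so the choice in
  \<open>matrix_inv\<close> is determined.\<close>

lemma matrix_inv_eqI:
  fixes A B :: "real^'n^'n"
  assumes "A ** B = mat 1"
  shows "matrix_inv A = B"
proof -
  have BA: "B ** A = mat 1"
    using assms by (simp add: matrix_left_right_inverse)
  have "A ** matrix_inv A = mat 1 \<and> matrix_inv A ** A = mat 1"
    unfolding matrix_inv_def by (rule someI[of _ B]) (use assms BA in simp)
  then have inv: "A ** matrix_inv A = mat 1" by simp
  have "matrix_inv A = (B ** A) ** matrix_inv A" by (simp add: BA)
  also have "\<dots> = B" by (simp add: matrix_mul_assoc[symmetric] inv)
  finally show ?thesis .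
qed

lemma smooth_function_exp_coord:
  "smooth_function (\<lambda>x::real^'n::finite. k * exp (r * x $ m))"
  using smooth_function_comp_coord[of "\<lambda>n s. k * r ^ n * exp (r * s)" m]
  by (force intro!: derivative_eq_intros)

lemma smooth_function_cosh_sinh_coord:
  "smooth_function (\<lambda>x::real^'n::finite. k * cosh (x $ m) - l * sinh (x $ m))"
proof -
  define F :: "nat \<Rightarrow> real \<Rightarrow> real" where
    "F n s = (if even n then k * cosh s - l * sinh s else k * sinh s - l * cosh s)" for n s
  have "(F n has_real_derivative F (Suc n) s) (at s)" for n s
    by (cases "even n") (auto simp: F_def[abs_def] intro!: derivative_eq_intros)
  from smooth_function_comp_coord[of F, OF this] show ?thesis
    by (simp add: F_def)
qed

lemma smooth_function_const: "smooth_function (\<lambda>x::real^'n::finite. k)"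
  using smooth_function_exp_coord[of k 0] by simp

lemma smooth_Phi_transf: "smooth_function (Phi_transf \<epsilon> c0 c1)"
proof -
  define F :: "nat \<Rightarrow> real \<Rightarrow> real" where
    "F n s = c1 * \<epsilon> ^ n * exp (\<epsilon> * s) +
       (if n = 0 then 2 * \<epsilon> * s + c0 else if n = 1 then 2 * \<epsilon> else 0)" for n s
  have "(F n has_real_derivative F (Suc n) s) (at s)" for n s
    by (cases "n = 0"; cases "n = 1")
       (auto simp: F_def[abs_def] intro!: derivative_eq_intros)
  from smooth_function_comp_coord[of F, OF this] show ?thesis
    by (simp add: F_def Phi_transf_def[abs_def] add_ac)
qed

section \<open>The metric, its inverse and its connection\<close>

locale transformed_metric =
  fixes \<epsilon> Q V H J :: real
  assumes eps: "\<epsilon> = 1 \<or> \<epsilon> = -1" and Q: "Q \<noteq> 0" and v: "V - \<epsilon> * H \<noteq> 0"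
begin

abbreviation G :: "real^3 \<Rightarrow> real^3^3" where
  "G \<equiv> G_transf \<epsilon> Q V H J"

definition a :: "real \<Rightarrow> real" where "a s = Q * exp (- 2 * \<epsilon> * s)"
definition b :: "real \<Rightarrow> real" where "b s = V * cosh s - H * sinh s"
definition c :: "real \<Rightarrow> real" where "c s = H * cosh s - V * sinh s"
text \<open>\<open>w = b - \<epsilon> c\<close>, and the determinant of the metric is \<open>- a w\<^sup>2\<close>.\<close>

definition w :: "real \<Rightarrow> real" where "w s = (V - \<epsilon> * H) * exp (\<epsilon> * s)"

lemma eps_square: "\<epsilon> * \<epsilon> = 1" "\<epsilon> * (\<epsilon> * z) = z"
  using eps by auto

lemma a_nz [simp]: "a s \<noteq> 0"
  using Q by (simp add: a_def)

lemma w_nz [simp]: "w s \<noteq> 0"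
  using v by (simp add: w_def)

text \<open>Rests on \<open>cosh s + \<epsilon> * sinh s = exp (\<epsilon> * s)\<close>. Eliminating
  \<open>b\<close> turns the identities for the inverse and the connection into rational ones in
  \<open>a\<close>, \<open>c\<close>, \<open>w\<close>.\<close>

lemma b_eq: "b s = w s + \<epsilon> * c s"
  using eps by (auto simp: b_def c_def w_def cosh_def sinh_def field_simps)

lemma G_eq: "G x = vector [
    vector [a (x$3), \<epsilon> * a (x$3), b (x$3)],
    vector [\<epsilon> * a (x$3), a (x$3), c (x$3)],
    vector [b (x$3), c (x$3), J]]"
  by (simp add: G_transf_def a_def b_def c_def mult.assoc)

lemma deriv_a: "deriv a s = - 2 * \<epsilon> * a s"
  by (rule DERIV_imp_deriv) (auto simp: a_def[abs_def] intro!: derivative_eq_intros)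

lemma deriv_eps_a: "deriv (\<lambda>s. \<epsilon> * a s) s = - 2 * a s"
  by (rule DERIV_imp_deriv)
     (auto simp: a_def[abs_def] eps_square intro!: derivative_eq_intros)

lemma deriv_b: "deriv b s = - c s"
  by (rule DERIV_imp_deriv) (auto simp: b_def[abs_def] c_def intro!: derivative_eq_intros)

lemma deriv_c: "deriv c s = - b s"
  by (rule DERIV_imp_deriv) (auto simp: c_def[abs_def] b_def intro!: derivative_eq_intros)

text \<open>The adjugate divided by the determinant; the entry 0 is the minor
  \<open>a\<^sup>2 - (\<epsilon> * a)\<^sup>2\<close>.\<close>

definition G_inv :: "real \<Rightarrow> real^3^3" where
  "G_inv s = vector [
    vector [((c s)\<^sup>2 - a s * J) / (a s * (w s)\<^sup>2),
            (\<epsilon> * a s * J - b s * c s) / (a s * (w s)\<^sup>2), 1 / w s],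
    vector [(\<epsilon> * a s * J - b s * c s) / (a s * (w s)\<^sup>2),
            ((b s)\<^sup>2 - a s * J) / (a s * (w s)\<^sup>2), - \<epsilon> / w s],
    vector [1 / w s, - \<epsilon> / w s, 0]]"

lemma G_mult_G_inv: "G x ** G_inv (x$3) = mat 1"
  using eps
  by (auto simp: G_eq G_inv_def b_eq matrix_matrix_mult_def mat_def vec_eq_iff forall_3 sum_3
      field_simps power2_eq_square)

lemma inv_metric_G: "inv_metric G i j x = G_inv (x$3) $ i $ j"
  by (simp add: inv_metric_def matrix_inv_eqI[OF G_mult_G_inv])

lemma partial_G: "partial k (\<lambda>x. G x $ i $ j) x = (if k = 3 then (vector [
    vector [- 2 * \<epsilon> * a (x$3), - 2 * a (x$3), - c (x$3)],
    vector [- 2 * a (x$3), - 2 * \<epsilon> * a (x$3), - b (x$3)],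
    vector [- c (x$3), - b (x$3), 0]] :: real^3^3) $ i $ j else 0)"
proof -
  have "\<forall>i j. partial k (\<lambda>x. G x $ i $ j) x = (if k = 3 then (vector [
    vector [- 2 * \<epsilon> * a (x$3), - 2 * a (x$3), - c (x$3)],
    vector [- 2 * a (x$3), - 2 * \<epsilon> * a (x$3), - b (x$3)],
    vector [- c (x$3), - b (x$3), 0]] :: real^3^3) $ i $ j else 0)"
    unfolding forall_3 G_eq vector_3
    using partial_comp_coord[of k a 3 x] partial_comp_coord[of k "\<lambda>s. \<epsilon> * a s" 3 x]
      partial_comp_coord[of k b 3 x] partial_comp_coord[of k c 3 x]
      partial_comp_coord[of k "\<lambda>s. J" 3 x]
    by (auto simp: deriv_a deriv_b deriv_c deriv_eps_a)
  then show ?thesis by blast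
qed

text \<open>The derivatives of \<open>A\<close> and \<open>C\<close> are affine in \<open>A\<close>
  and \<open>C\<close> themselves, so no quotients arise in the curvature from differentiating
  them.\<close>

definition A :: "real \<Rightarrow> real" where "A s = a s / w s"
definition C :: "real \<Rightarrow> real" where "C s = c s / w s"

text \<open>\<open>Gam s $ k $ i $ j\<close> is \<open>\<Gamma>\<^sup>k\<^sub>i\<^sub>j\<close>; the occurrences of \<open>b / w\<close> have been rewritten as
  \<open>1 + \<epsilon> C\<close>.\<close>

definition Gam :: "real \<Rightarrow> real^3^3^3" where
  "Gam s = vector [
    vector [vector [\<epsilon> * A s, A s, C s],
            vector [A s, \<epsilon> * A s, \<epsilon> * C s],
            vector [C s, \<epsilon> * C s, (c s * (b s + \<epsilon> * c s) - \<epsilon> * a s * J) / (a s * w s)]],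
    vector [vector [- A s, - (\<epsilon> * A s), - 1 - \<epsilon> * C s],
            vector [- (\<epsilon> * A s), - A s, - \<epsilon> - C s],
            vector [- 1 - \<epsilon> * C s, - \<epsilon> - C s, (a s * J - b s * (b s + \<epsilon> * c s)) / (a s * w s)]],
    vector [vector [0, 0, 0], vector [0, 0, 0], vector [0, 0, \<epsilon>]]]"

lemma christoffel_G: "christoffel G k i j x = Gam (x$3) $ k $ i $ j"
proof -
  have "\<forall>k i j. christoffel G k i j x = Gam (x$3) $ k $ i $ j"
    unfolding forall_3 using eps
    by (auto simp: christoffel_def inv_metric_G partial_G sum_3 G_inv_def Gam_def A_def C_def b_eq
      field_simps power2_eq_square)
  then show ?thesis by blast
qed

lemma DERIV_w: "(w has_real_derivative \<epsilon> * w s) (at s)"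
  by (auto simp: w_def[abs_def] intro!: derivative_eq_intros)

lemma DERIV_A: "(A has_real_derivative - 3 * \<epsilon> * A s) (at s)"
proof -
  have "(a has_real_derivative - 2 * \<epsilon> * a s) (at s)"
    by (auto simp: a_def[abs_def] intro!: derivative_eq_intros)
  with DERIV_w show ?thesis
    unfolding A_def[abs_def]
    by (auto simp: field_simps power2_eq_square intro!: derivative_eq_intros)
qed

lemma DERIV_C: "(C has_real_derivative - 1 - 2 * \<epsilon> * C s) (at s)"
proof -
  have "(c has_real_derivative - b s) (at s)"
    by (auto simp: c_def[abs_def] b_def intro!: derivative_eq_intros)
  with DERIV_w show ?thesis
    unfolding C_def[abs_def]
    by (auto simp: b_eq field_simps power2_eq_square intro!: derivative_eq_intros)
qed

lemmas deriv_A_C = DERIV_imp_deriv[OF DERIV_A] DERIV_imp_deriv[OF DERIV_C]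

text \<open>These are the composite entries of \<open>Gam\<close> built from \<open>A\<close> and
  \<open>C\<close>. The two long entries need no derivative: in the Ricci tensor they are
  differentiated only along directions 1 and 2.\<close>

lemma deriv_affine_A_C:
  "deriv (\<lambda>s. \<epsilon> * A s) s = - 3 * A s"
  "deriv (\<lambda>s. - A s) s = 3 * \<epsilon> * A s"
  "deriv (\<lambda>s. - (\<epsilon> * A s)) s = 3 * A s"
  "deriv (\<lambda>s. \<epsilon> * C s) s = - \<epsilon> - 2 * C s"
  "deriv (\<lambda>s. - 1 - \<epsilon> * C s) s = \<epsilon> + 2 * C s"
  "deriv (\<lambda>s. - \<epsilon> - C s) s = 1 + 2 * \<epsilon> * C s"
  by (rule DERIV_imp_deriv, (rule derivative_eq_intros DERIV_A DERIV_C refl)+,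
      simp add: algebra_simps eps_square)+

section \<open>Curvature\<close>

lemma partial_christoffel_G: "partial l (christoffel G k i j) x =
   (if l = 3 then deriv (\<lambda>s. Gam s $ k $ i $ j) (x$3) else 0)"
  unfolding christoffel_G[abs_def] by (rule partial_comp_coord)

text \<open>The determinant is constant, so the traces
  \<open>\<Gamma>\<^sup>k\<^sub>k\<^sub>i\<close> vanish, and the symbols with upper index 3 are
  constant. What remains is minus the sum of \<open>\<Gamma>\<^sup>k\<^sub>j\<^sub>m
  \<Gamma>\<^sup>m\<^sub>k\<^sub>i\<close>; for \<open>i = j = 3\<close> this sum is the trace of a
  squared matrix, equal to 2.\<close>

lemma ricci_G: "ricci G i j x = (if i = 3 \<and> j = 3 then -2 else 0)"
proof -
  have "\<forall>i j. ricci G i j x = (if i = 3 \<and> j = 3 then -2 else 0)"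
    unfolding forall_3 ricci_def riemann_def partial_christoffel_G sum_3 christoffel_G
    by (simp add: Gam_def deriv_A_C deriv_affine_A_C) (simp add: algebra_simps eps_square)
  then show ?thesis by blast
qed

lemma scalar_curvature_G: "scalar_curvature G x = 0"
  by (simp add: scalar_curvature_def ricci_G sum_3 inv_metric_G G_inv_def)

lemma pseudo_riemannian_G: "pseudo_riemannian_metric G"
proof -
  have "\<forall>i j. smooth_function (\<lambda>x. G x $ i $ j)"
    unfolding forall_3 G_transf_def
    using smooth_function_exp_coord[of Q "- 2 * \<epsilon>" "3::3"]
      smooth_function_exp_coord[of "\<epsilon> * Q" "- 2 * \<epsilon>" "3::3"]
    by (simp add: smooth_function_cosh_sinh_coord smooth_function_const)
  moreover have "transpose (G x) = G x" for x
    by (simp add: G_eq transpose_def vec_eq_iff forall_3)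
  moreover have "invertible (G x)" for x
    using G_mult_G_inv invertible_right_inverse by blast
  ultimately show ?thesis by (simp add: pseudo_riemannian_metric_def)
qed

section \<open>Dilaton and beta equations\<close>

lemma nabla_nabla_G:
  "nabla_nabla G (\<lambda>x. f (x$3)) i j x =
     (if i = 3 \<and> j = 3 then deriv (deriv f) (x$3) - \<epsilon> * deriv f (x$3) else 0)"
proof -
  have "partial i (partial j (\<lambda>x. f (x$3))) x =
    (if i = 3 \<and> j = 3 then deriv (deriv f) (x$3) else 0)" for i j :: 3
  proof -
    \<comment> \<open>Moving the case distinction inside the function of \<open>x$3\<close> lets
      \<open>partial_comp_coord\<close> apply a second time.\<close>
    have "partial j (\<lambda>x. f (x$3)) = (\<lambda>x. (if j = 3 then deriv f else (\<lambda>s. 0)) (x$3))"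
      by (auto simp: partial_comp_coord)
    then show ?thesis
      using partial_comp_coord[of i "if j = 3 then deriv f else (\<lambda>s. 0)" 3 x] by auto
  qed
  note this[simp]
  have "\<forall>i j. nabla_nabla G (\<lambda>x. f (x$3)) i j x =
     (if i = 3 \<and> j = 3 then deriv (deriv f) (x$3) - \<epsilon> * deriv f (x$3) else 0)"
    unfolding forall_3 nabla_nabla_def nabla_covector_def sum_3 christoffel_G
    by (simp add: Gam_def partial_comp_coord)
  then show ?thesis by blast
qed

lemma beta_equations_G:
  "vanishing_beta_equations G (Phi_transf \<epsilon> c0 c1) (\<lambda>i j k x. 0)"
proof -
  define f where "f s = 2 * \<epsilon> * s + c1 * exp (\<epsilon> * s) + c0" for s
  have Phi: "Phi_transf \<epsilon> c0 c1 = (\<lambda>x. f (x$3))"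
    by (simp add: Phi_transf_def[abs_def] f_def)
  have f': "deriv f = (\<lambda>s. 2 * \<epsilon> + c1 * \<epsilon> * exp (\<epsilon> * s))"
    by (rule ext, rule DERIV_imp_deriv)
       (auto simp: f_def[abs_def] intro!: derivative_eq_intros)
  have f'': "deriv (deriv f) s = c1 * exp (\<epsilon> * s)" for s
    unfolding f' by (rule DERIV_imp_deriv)
      (auto intro!: derivative_eq_intros simp: eps_square algebra_simps)
  \<comment> \<open>The exponential solves \<open>f'' = \<epsilon> * f'\<close>, which leaves
    \<open>c1\<close> free; the slope \<open>2 * \<epsilon>\<close> of the linear term yields the
    -2.\<close>
  have hess: "nabla_nabla G (\<lambda>x. f (x$3)) i j x = (if i = 3 \<and> j = 3 then -2 else 0)" for i j x
    by (simp add: nabla_nabla_G f'') (simp add: f' algebra_simps eps_square)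
  have "partial i (\<lambda>x. 0) x = 0" for i and x :: "real^3"
    by (simp add: partial_def)
  then show ?thesis
    unfolding vanishing_beta_equations_def Phi hess ricci_G scalar_curvature_G
    by (simp add: nabla_3tensor_def sum_3 inv_metric_G G_inv_def partial_comp_coord)
qed

end

section \<open>Dependence of the dilaton on the dual coordinates\<close>

lemma independent_of_dual_iff:
  assumes "q \<noteq> 0" "v \<noteq> 0"
  shows "independent_of_dual (\<lambda>u ut. Phi_U q v c0 c1 c2 c3 (y_coords \<epsilon> \<beta> u ut))
    \<longleftrightarrow> c2 = 0 \<and> c3 = 0"
proof
  assume indep: "independent_of_dual (\<lambda>u ut. Phi_U q v c0 c1 c2 c3 (y_coords \<epsilon> \<beta> u ut))"
  have "Phi_U q v c0 c1 c2 c3 (y_coords \<epsilon> \<beta> 0 (vector [0, t, 0]))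
      = Phi_U q v c0 c1 c2 c3 (y_coords \<epsilon> \<beta> 0 0)" for t
    using indep unfolding independent_of_dual_def by blast
  \<comment> \<open>Only \<open>y$2\<close> involves the dual coordinates, and the dilaton is
    quadratic in it. At \<open>u = 0\<close> the values \<open>t = 2\<close> and
    \<open>t = -2\<close> give \<open>y$2 = 1\<close> and \<open>y$2 = -1\<close>, which separates
    the odd and even coefficients.\<close>
  from this[of 2] this[of "-2"] have "c2 + c3 * (q / (2 * v)) = 0" "- c2 + c3 * (q / (2 * v)) = 0"
    by (simp_all add: Phi_U_def y_coords_def)
  then have "c2 = 0" "c3 * (q / (2 * v)) = 0" by linarith+
  then show "c2 = 0 \<and> c3 = 0" using assms by simp
next
  assume "c2 = 0 \<and> c3 = 0"
  then show "independent_of_dual (\<lambda>u ut. Phi_U q v c0 c1 c2 c3 (y_coords \<epsilon> \<beta> u ut))"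
    by (simp add: independent_of_dual_def Phi_U_def y_coords_def)
qed

theorem mainTheorem1:
  fixes \<epsilon> Q V H J q v \<alpha> \<beta> :: real
  assumes "\<epsilon> \<in> {1, -1}"
    and "Q \<noteq> 0"
    and "V - \<epsilon> * H \<noteq> 0"
    and "q = 1 / Q"
    and "v = V - \<epsilon> * H"
    and "\<alpha> = (\<epsilon> * V + H) / (2 * Q)"
    and "\<beta> = \<epsilon> * ((\<alpha>\<^sup>2 * Q - J) / (2 * v))"
  shows "pseudo_riemannian_metric (G_transf \<epsilon> Q V H J)
    \<and> (\<forall>u. \<exists>i j. ricci (G_transf \<epsilon> Q V H J) i j u \<noteq> 0)
    \<and> (\<forall>u. scalar_curvature (G_transf \<epsilon> Q V H J) u = 0)
    \<and> (\<forall>c0 c1 c2 c3. v * c2\<^sup>2 + 2 * q * c1 * c3 = 0 \<longrightarrow>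
         (independent_of_dual (\<lambda>u ut. Phi_U q v c0 c1 c2 c3 (y_coords \<epsilon> \<beta> u ut))
            \<longleftrightarrow> c2 = 0 \<and> c3 = 0)
         \<and> (c2 = 0 \<and> c3 = 0 \<longrightarrow>
              (\<forall>u ut. Phi_U q v c0 c1 c2 c3 (y_coords \<epsilon> \<beta> u ut) = Phi_transf \<epsilon> c0 c1 u)))
    \<and> (\<forall>c0 c1. smooth_function (Phi_transf \<epsilon> c0 c1)
         \<and> vanishing_beta_equations (G_transf \<epsilon> Q V H J) (Phi_transf \<epsilon> c0 c1) (\<lambda>i j k x. 0))"
proof -
  interpret transformed_metric \<epsilon> Q V H J
    using assms by unfold_locales auto
  have "\<exists>i j. ricci G i j u \<noteq> 0" for u
    by (auto simp: ricci_G intro: exI[of _ 3])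
  moreover have "independent_of_dual (\<lambda>u ut. Phi_U q v c0 c1 c2 c3 (y_coords \<epsilon> \<beta> u ut))
      \<longleftrightarrow> c2 = 0 \<and> c3 = 0" for c0 c1 c2 c3
    using independent_of_dual_iff[of q v] assms by simp
  moreover have "Phi_U q v c0 c1 0 0 (y_coords \<epsilon> \<beta> u ut) = Phi_transf \<epsilon> c0 c1 u" for c0 c1 u ut
    by (simp add: Phi_U_def y_coords_def Phi_transf_def)
  ultimately show ?thesis
    by (auto simp: pseudo_riemannian_G scalar_curvature_G smooth_Phi_transf beta_equations_G)
qed

end
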